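(* Let $Z$ be a real $m\times n$ matrix with $\operatorname{rank}(Z)=n$, smallest singular value $\sigma_z=1/\|Z^\dagger\|_2$, and largest squared row norm $\mu_z\equiv\max_{1\le j\le m}\|e_j^TZ\|_2^2$. Let $D=\operatorname{diag}(d_1,\dots,d_m)$ be an $m\times m$ diagonal matrix with non-negative diagonal elements, labeled in non-increasing order as $\|D\|_2=d_{[1]}\ge\cdots\ge d_{[m]}\ge0$. If $t\equiv\lfloor\sigma_z^2/\mu_z\rfloor$, then $$\|DZ\|_2^2\le\begin{cases}\mu_z\sum_{j=1}^t d_{[j]}^2+\left(\|Z\|_2^2-t\,\mu_z\right)d_{[t+1]}^2 & \text{if } \|Z\|_2^2-t\,\mu_z\le\mu_z,\\[4pt] \mu_z\sum_{j=2}^{t+1}d_{[j]}^2+\left(\|Z\|_2^2-t\,\mu_z\right)d_{[1]}^2 & \text{otherwise.}\end{cases}$$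
   Context: Here $e_1,\dots,e_m$ are the canonical (column) basis vectors of $\mathbb{R}^m$, $\|\cdot\|_2$ is the Euclidean two-norm (for vectors and matrices), and $Z^\dagger$ is the Moore-Penrose inverse. If $t=m$ (which can happen only when $n=1$ and $\|Z\|_2^2-t\mu_z=0$), the term $(\|Z\|_2^2-t\mu_z)\,d_{[t+1]}^2$ is interpreted as $0$. *)

theory Defs
  imports "HOL-Analysis.Analysis"
begin

definition two_norm :: "real^'n^'m \<Rightarrow> real" where
  "two_norm A = onorm ((*v) A)"

text \<open>The four Penrose conditions.\<close>

definition is_pinv :: "real^'n^'m \<Rightarrow> real^'m^'n \<Rightarrow> bool" where
  "is_pinv A X \<longleftrightarrow>
     A ** X ** A = A \<and>
     X ** A ** X = X \<and>
     transpose (A ** X) = A ** X \<and>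
     transpose (X ** A) = X ** A"

definition pinv :: "real^'n^'m \<Rightarrow> real^'m^'n" where
  "pinv A = (THE X. is_pinv A X)"

lemma is_pinv_unique:
  assumes X: "is_pinv A X" and Y: "is_pinv A Y"
  shows "X = Y"
proof -
  have AX: "A ** X = A ** Y"
  proof -
    have "A ** X = transpose (A ** Y ** (A ** X))"
      using X Y unfolding is_pinv_def by (metis matrix_mul_assoc)
    also have "\<dots> = (A ** X) ** (A ** Y)"
      using X Y unfolding is_pinv_def by (metis matrix_transpose_mul)
    also have "\<dots> = A ** Y"
      using X Y unfolding is_pinv_def by (metis matrix_mul_assoc)
    finally show ?thesis .
  qed
  have XA: "X ** A = Y ** A"
  proof -
    have "X ** A = transpose (X ** A ** (Y ** A))"
      using X Y unfolding is_pinv_def by (metis matrix_mul_assoc)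
    also have "\<dots> = (Y ** A) ** (X ** A)"
      using X Y unfolding is_pinv_def by (metis matrix_transpose_mul)
    also have "\<dots> = Y ** A"
      using X Y unfolding is_pinv_def by (metis matrix_mul_assoc)
    finally show ?thesis .
  qed
  have "X = X ** A ** X" using X by (simp add: is_pinv_def)
  also have "\<dots> = Y ** (A ** X)" using XA by (simp add: matrix_mul_assoc)
  also have "\<dots> = Y ** A ** Y" using AX by (simp add: matrix_mul_assoc)
  also have "\<dots> = Y" using Y by (simp add: is_pinv_def)
  finally show ?thesis .
qed

lemma is_pinv_full_column_rank:
  fixes A :: "real^'n^'m"
  assumes "rank A = CARD('n)"
  shows "is_pinv A (matrix_inv (transpose A ** A) ** transpose A)"
proof -
  let ?G = "transpose A ** A"
  have inj: "inj ((*v) A)"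
    using assms by (simp add: full_rank_injective)
  have "x = 0" if "?G *v x = 0" for x
  proof -
    have "(A *v x) \<bullet> (A *v x) = x \<bullet> (?G *v x)"
      using dot_lmul_matrix[of "A *v x" A x]
      by (simp add: matrix_vector_mul_assoc[symmetric] inner_commute)
    then have "A *v x = A *v 0" using that by simp
    then show ?thesis using inj by (meson injD)
  qed
  then have inv: "invertible ?G"
    by (metis invertible_left_inverse matrix_left_invertible_ker)
  let ?H = "matrix_inv ?G"
  have GH: "?G ** ?H = mat 1" and HG: "?H ** ?G = mat 1"
    using inv someI_ex[of "\<lambda>H. ?G ** H = mat 1 \<and> H ** ?G = mat 1"]
    unfolding invertible_def matrix_inv_def by blast+
  have tG: "transpose ?G = ?G" by (simp add: matrix_transpose_mul)
  have "transpose ?H = transpose ?H ** (?G ** ?H)" using GH by simp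
  also have "\<dots> = transpose (?G ** ?H) ** ?H"
    by (metis matrix_mul_assoc matrix_transpose_mul tG)
  finally have tH: "transpose ?H = ?H" using GH by (simp add: transpose_mat)
  have XA: "?H ** transpose A ** A = mat 1" using HG by (simp add: matrix_mul_assoc)
  show ?thesis unfolding is_pinv_def
    using XA tH
    by (simp add: matrix_transpose_mul matrix_mul_assoc[symmetric] transpose_mat)
qed

lemma is_pinv_pinv:
  fixes A :: "real^'n^'m"
  assumes "rank A = CARD('n)"
  shows "is_pinv A (pinv A)"
  unfolding pinv_def
  by (rule theI[where P = "is_pinv A"])
     (use assms is_pinv_full_column_rank is_pinv_unique in blast)+

definition diag_mat :: "real^'m \<Rightarrow> real^'m^'m" where
  "diag_mat d = (\<chi> i j. if i = j then d $ i else 0)"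

definition max_row_norm_sq :: "real^'n^'m \<Rightarrow> real" where
  "max_row_norm_sq A = Max (range (\<lambda>j. (norm (row j A))\<^sup>2))"

text \<open>\<open>p\<close> enumerates the diagonal of \<open>diag_mat d\<close> in non-increasing order, so that the
  \<open>j\<close>-th largest diagonal element is \<open>d $ p j\<close>, with \<open>j\<close> starting at 1. Ties make \<open>p\<close>
  non-unique, but not the values \<open>d $ p j\<close>.\<close>

definition decreasing_labeling :: "real^'m \<Rightarrow> (nat \<Rightarrow> 'm) \<Rightarrow> bool" where
  "decreasing_labeling d p \<longleftrightarrow>
     bij_betw p {1..CARD('m)} UNIV \<and>
     (\<forall>i j. 1 \<le> i \<and> i \<le> j \<and> j \<le> CARD('m) \<longrightarrow> d $ p j \<le> d $ p i)"

end

theory Submission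
  imports Defs
begin

text \<open>For a vector \<open>x\<close> of norm 1 put \<open>w\<^sub>j = (Z x)\<^sub>j\<^sup>2\<close>. By Cauchy--Schwarz \<open>w\<^sub>j \<le> \<mu>\<close>, and the \<open>w\<^sub>j\<close> sum
  to at most \<open>\<parallel>Z\<parallel>\<^sup>2\<close>, so \<open>\<parallel>D Z x\<parallel>\<^sup>2 = \<Sum> d\<^sub>j\<^sup>2 w\<^sub>j\<close> is bounded by giving the full weight \<open>\<mu>\<close> to the
  \<open>t\<close> largest \<open>d\<^sub>j\<^sup>2\<close> and the remaining mass to the next one. The smallest singular value
  only serves to guarantee \<open>t \<le> m\<close>. The bound of the second case is weaker, as it moves mass
  from the \<open>(t+1)\<close>-st largest \<open>d\<^sub>j\<^sup>2\<close> to the largest one.\<close>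

lemma two_norm_nonneg: "two_norm A \<ge> 0"
  unfolding two_norm_def by (simp add: onorm_pos_le)

lemma norm_matrix_vector_mult_le_two_norm: "norm (A *v x) \<le> two_norm A * norm x"
  unfolding two_norm_def by (rule onorm) simp

lemma norm_sq_matrix_vector_mult_le_two_norm:
  "(norm (A *v x))\<^sup>2 \<le> (two_norm A)\<^sup>2 * (norm x)\<^sup>2"
  by (metis norm_matrix_vector_mult_le_two_norm norm_ge_zero power_mono power_mult_distrib)

lemma two_norm_sq_le:
  fixes A :: "real^'n^'m"
  assumes "\<And>x. (norm (A *v x))\<^sup>2 \<le> B * (norm x)\<^sup>2"
  shows "(two_norm A)\<^sup>2 \<le> B"
proof -
  \<comment> \<open>\<open>axis undefined 1\<close> is an arbitrary unit vector. Testing on it gives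
    \<open>0 \<le> B\<close>, so that \<open>sqrt B\<close> can bound the operator norm.\<close>
  have "0 \<le> (norm (A *v axis undefined 1))\<^sup>2" by simp
  also have "\<dots> \<le> B" using assms[of "axis undefined 1"] by simp
  finally have B: "0 \<le> B" .
  have "norm (A *v x) \<le> sqrt B * norm x" for x
    using assms[of x] by - (rule power2_le_imp_le, auto simp: power_mult_distrib B)
  then have "two_norm A \<le> sqrt B"
    unfolding two_norm_def by (rule onorm_le)
  then show ?thesis
    using B two_norm_nonneg[of A] by (metis power_mono real_sqrt_pow2)
qed

lemma matrix_vector_mult_component_sq_le:
  fixes A :: "real^'n^'m"
  shows "((A *v x) $ j)\<^sup>2 \<le> max_row_norm_sq A * (norm x)\<^sup>2"
proof -
  have "((A *v x) $ j)\<^sup>2 = (row j A \<bullet> x)\<^sup>2"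
    by (simp add: matrix_vector_mul_component row_def)
  also have "\<dots> \<le> (norm (row j A))\<^sup>2 * (norm x)\<^sup>2"
    by (simp add: Cauchy_Schwarz_ineq power2_norm_eq_inner)
  also have "\<dots> \<le> max_row_norm_sq A * (norm x)\<^sup>2"
    unfolding max_row_norm_sq_def by (intro mult_right_mono Max_ge) auto
  finally show ?thesis .
qed

lemma norm_sq_vec_eq_sum: "(norm (x :: real^'m))\<^sup>2 = (\<Sum>j\<in>UNIV. (x $ j)\<^sup>2)"
  unfolding power2_norm_eq_inner inner_vec_def by (simp add: power2_eq_square)

text \<open>Summing the row-wise bound over all rows. It caps both the largest and the smallest
  squared singular value by the number of rows times the largest squared row norm.\<close>

lemma norm_sq_matrix_vector_mult_le_max_row:
  fixes A :: "real^'n^'m"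
  shows "(norm (A *v x))\<^sup>2 \<le> real CARD('m) * max_row_norm_sq A * (norm x)\<^sup>2"
proof -
  have "(\<Sum>j\<in>UNIV. ((A *v x) $ j)\<^sup>2) \<le> (\<Sum>j\<in>(UNIV::'m set). max_row_norm_sq A * (norm x)\<^sup>2)"
    by (intro sum_mono matrix_vector_mult_component_sq_le)
  then show ?thesis by (simp add: norm_sq_vec_eq_sum)
qed

lemma max_row_norm_sq_nonneg: "max_row_norm_sq A \<ge> 0"
  using order_trans[OF zero_le_power2 matrix_vector_mult_component_sq_le[of A "axis undefined 1"]]
  by simp

lemma diag_mat_mult_component: "(diag_mat d *v y) $ j = d $ j * y $ j"
  by (simp add: diag_mat_def matrix_vector_mult_def if_distrib[of "\<lambda>a. a * _"] cong: if_cong)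

text \<open>Applying \<open>X\<close> to \<open>A *v x\<close> recovers the unit vector
  \<open>x\<close>, so \<open>A\<close> cannot shrink it by more than \<open>X\<close> can stretch.
  With \<open>X = pinv A\<close> the left side is the smallest singular value.\<close>

lemma inverse_two_norm_left_inverse_le:
  fixes A :: "real^'n^'m"
  assumes "X ** A = mat 1" and "norm x = 1"
  shows "1 / two_norm X \<le> norm (A *v x)"
proof -
  have "1 = norm (X *v (A *v x))"
    using assms by (simp add: matrix_vector_mul_assoc)
  also have "\<dots> \<le> two_norm X * norm (A *v x)"
    by (rule norm_matrix_vector_mult_le_two_norm)
  finally have "1 \<le> two_norm X * norm (A *v x)" .
  then show ?thesis
    using two_norm_nonneg[of X] by (cases "two_norm X = 0") (auto simp: field_simps)
qed

text \<open>Full column rank makes \<open>A\<close> injective, so the leftmost \<open>A\<close>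
  cancels in the first Penrose condition.\<close>

lemma pinv_left_inverse:
  fixes A :: "real^'n^'m"
  assumes "rank A = CARD('n)"
  shows "pinv A ** A = mat 1"
proof -
  have "A *v ((pinv A ** A) *v x) = A *v x" for x
    using is_pinv_pinv[OF assms] by (simp add: is_pinv_def matrix_vector_mul_assoc matrix_mul_assoc)
  then have "(pinv A ** A) *v x = mat 1 *v x" for x
    using assms full_rank_injective[of A] by (simp add: inj_eq)
  then show ?thesis by (subst matrix_eq) simp
qed

lemma sum_capped_weights_le:
  fixes a w :: "nat \<Rightarrow> real"
  assumes antimono: "\<And>i j. 1 \<le> i \<Longrightarrow> i \<le> j \<Longrightarrow> j \<le> m \<Longrightarrow> a j \<le> a i"
    and w: "\<And>j. w j \<ge> 0" "\<And>j. w j \<le> \<mu>"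
    and mass: "(\<Sum>j = 1..m. w j) \<le> N"
    and k: "k < m" "a (k + 1) \<ge> 0"
  shows "(\<Sum>j = 1..m. a j * w j) \<le> \<mu> * (\<Sum>j = 1..k. a j) + (N - real k * \<mu>) * a (k + 1)"
proof -
  define c where "c = a (k + 1)"
  have split: "{1..m} = {1..k} \<union> {k+1..m}" using k by auto
  have "(\<Sum>j = 1..m. (a j - c) * w j)
      = (\<Sum>j = 1..k. (a j - c) * w j) + (\<Sum>j = k+1..m. (a j - c) * w j)"
    unfolding split by (rule sum.union_disjoint) auto
  also have "\<dots> \<le> (\<Sum>j = 1..k. (a j - c) * \<mu>) + 0"
    unfolding c_def using w k
    by (intro add_mono sum_mono mult_left_mono sum_nonpos mult_nonpos_nonneg)
       (auto intro!: antimono)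
  finally have "(\<Sum>j = 1..m. (a j - c) * w j) \<le> (\<Sum>j = 1..k. (a j - c) * \<mu>)" by simp
  moreover have "c * (\<Sum>j = 1..m. w j) \<le> c * N"
    using mass k by (auto simp: c_def intro: mult_left_mono)
  ultimately show ?thesis
    by (simp add: c_def algebra_simps sum_subtractf sum_distrib_left sum.distrib)
qed

theorem theoremB4:
  fixes Z :: "real^'n^'m" and d :: "real^'m" and p :: "nat \<Rightarrow> 'm"
    and D :: "real^'m^'m" and \<sigma> \<mu> :: real and t :: nat
  assumes "rank Z = CARD('n)"
    and "\<sigma> = 1 / two_norm (pinv Z)"
    and "\<mu> = max_row_norm_sq Z"
    and "D = diag_mat d"
    and "\<forall>i. d $ i \<ge> 0"
    and "decreasing_labeling d p"
    and "t = nat \<lfloor>\<sigma>\<^sup>2 / \<mu>\<rfloor>"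
  shows "(two_norm (D ** Z))\<^sup>2 \<le>
    (if (two_norm Z)\<^sup>2 - real t * \<mu> \<le> \<mu>
     then \<mu> * (\<Sum>j = 1..t. (d $ p j)\<^sup>2)
          + (if t = CARD('m) then 0
             else ((two_norm Z)\<^sup>2 - real t * \<mu>) * (d $ p (t + 1))\<^sup>2)
     else \<mu> * (\<Sum>j = 2..t + 1. (d $ p j)\<^sup>2)
          + ((two_norm Z)\<^sup>2 - real t * \<mu>) * (d $ p 1)\<^sup>2)"
proof -
  define N where "N = (two_norm Z)\<^sup>2"
  define a where "a j = (d $ p j)\<^sup>2" for j
  let ?m = "CARD('m)"
  have p: "bij_betw p {1..?m} UNIV"
    and d_antimono: "\<And>i j. 1 \<le> i \<Longrightarrow> i \<le> j \<Longrightarrow> j \<le> ?m \<Longrightarrow> d $ p j \<le> d $ p i"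
    using assms(6) by (auto simp: decreasing_labeling_def)
  have a_antimono: "a j \<le> a i" if "1 \<le> i" "i \<le> j" "j \<le> ?m" for i j
    using d_antimono[OF that] assms(5) by (simp add: a_def power_mono)
  have \<mu>: "\<mu> \<ge> 0" by (simp add: assms(3) max_row_norm_sq_nonneg)
  have sum_p: "(\<Sum>j = 1..?m. g (p j)) = (\<Sum>i\<in>UNIV. g i)" for g :: "'m \<Rightarrow> real"
    by (rule sum.reindex_bij_betw[OF p])
  have DZ: "(norm ((D ** Z) *v x))\<^sup>2 = (\<Sum>j = 1..?m. a j * ((Z *v x) $ p j)\<^sup>2)" for x
    unfolding a_def sum_p[of "\<lambda>i. (d $ i)\<^sup>2 * ((Z *v x) $ i)\<^sup>2"]
    by (simp add: norm_sq_vec_eq_sum assms(4) diag_mat_mult_component power_mult_distrib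
        flip: matrix_vector_mul_assoc)
  have w_le: "((Z *v x) $ j)\<^sup>2 \<le> \<mu> * (norm x)\<^sup>2" for x j
    unfolding assms(3) by (rule matrix_vector_mult_component_sq_le)
  have N_le: "N \<le> real ?m * \<mu>"
    unfolding N_def assms(3) by (intro two_norm_sq_le norm_sq_matrix_vector_mult_le_max_row)
  have t_le: "t \<le> ?m"
  \<comment> \<open>If \<open>\<mu> = 0\<close>, division by zero yields 0 and hence
    \<open>t = 0\<close>. Otherwise any unit vector separates \<open>\<sigma>\<close> from the row
    bound.\<close>
  proof (cases "\<mu> = 0")
    case False
    have "\<sigma> \<le> norm (Z *v axis undefined 1)"
      unfolding assms(2)
      by (intro inverse_two_norm_left_inverse_le pinv_left_inverse assms(1)) simp
    moreover have "0 \<le> \<sigma>" by (simp add: assms(2) two_norm_nonneg)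
    ultimately have "\<sigma>\<^sup>2 \<le> (norm (Z *v axis undefined 1))\<^sup>2" by (intro power_mono)
    also have "\<dots> \<le> real ?m * \<mu>"
      using norm_sq_matrix_vector_mult_le_max_row[of Z "axis undefined 1"]
      by (simp add: assms(3))
    finally have "\<sigma>\<^sup>2 / \<mu> \<le> real ?m"
      using \<mu> False by (simp add: field_simps)
    then show ?thesis unfolding assms(7) by linarith
  qed (simp add: assms(7))
  have greedy: "(two_norm (D ** Z))\<^sup>2 \<le> \<mu> * (\<Sum>j = 1..t. a j) + (N - real t * \<mu>) * a (t + 1)"
    if "t < ?m"
  proof (rule two_norm_sq_le)
    fix x
    have "(\<Sum>j = 1..?m. ((Z *v x) $ p j)\<^sup>2) \<le> N * (norm x)\<^sup>2"
      unfolding sum_p[of "\<lambda>i. ((Z *v x) $ i)\<^sup>2"] N_def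
      using norm_sq_matrix_vector_mult_le_two_norm[of Z x] by (simp add: norm_sq_vec_eq_sum)
    \<comment> \<open>Cap and mass are both scaled by the squared norm of \<open>x\<close>, which
      replaces normalizing \<open>x\<close> and covers \<open>x = 0\<close>.\<close>
    then have "(norm ((D ** Z) *v x))\<^sup>2
        \<le> \<mu> * (norm x)\<^sup>2 * (\<Sum>j = 1..t. a j)
          + (N * (norm x)\<^sup>2 - real t * (\<mu> * (norm x)\<^sup>2)) * a (t + 1)"
      unfolding DZ by (intro sum_capped_weights_le a_antimono w_le that) (auto simp: a_def)
    then show "(norm ((D ** Z) *v x))\<^sup>2
        \<le> (\<mu> * (\<Sum>j = 1..t. a j) + (N - real t * \<mu>) * a (t + 1)) * (norm x)\<^sup>2"
      by (simp add: algebra_simps)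
  qed
  \<comment> \<open>For \<open>t = ?m\<close> there is no next diagonal element to serve as pivot;
    capping every weight by \<open>\<mu>\<close> suffices.\<close>
  have full: "(two_norm (D ** Z))\<^sup>2 \<le> \<mu> * (\<Sum>j = 1..?m. a j)"
  proof (rule two_norm_sq_le)
    fix x
    have "(norm ((D ** Z) *v x))\<^sup>2 \<le> (\<Sum>j = 1..?m. a j * (\<mu> * (norm x)\<^sup>2))"
      unfolding DZ by (intro sum_mono mult_left_mono w_le) (simp add: a_def)
    then show "(norm ((D ** Z) *v x))\<^sup>2 \<le> \<mu> * (\<Sum>j = 1..?m. a j) * (norm x)\<^sup>2"
      by (simp add: sum_distrib_left sum_distrib_right mult_ac)
  qed
  show ?thesis
  proof (cases "N - real t * \<mu> \<le> \<mu>")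
    case True
    then show ?thesis
      using greedy full t_le by (cases "t = ?m") (auto simp: N_def a_def)
  next
    case False
    \<comment> \<open>At \<open>t = ?m\<close> the remainder \<open>N - real t * \<mu>\<close> would
      be at most 0, which belongs to the first case.\<close>
    have t: "t < ?m"
    proof (rule ccontr)
      assume "\<not> t < ?m"
      then have "t = ?m" using t_le by simp
      then show False using False N_le \<mu> by simp
    qed
    have "(\<Sum>j = 1..t. a j) + a (t + 1) = a 1 + (\<Sum>j = 2..t + 1. a j)"
      using sum.atLeast_Suc_atMost[of 1 "t + 1" a] by (simp add: numeral_2_eq_2)
    then have shift: "(\<Sum>j = 1..t. a j) = a 1 + (\<Sum>j = 2..t + 1. a j) - a (t + 1)" by simp
    \<comment> \<open>By \<open>shift\<close>, this product is exactly the second bound minus the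
      greedy one.\<close>
    have "0 \<le> (N - real t * \<mu> - \<mu>) * (a 1 - a (t + 1))"
      using False a_antimono[of 1 "t + 1"] t by (intro mult_nonneg_nonneg) auto
    then have "\<mu> * (\<Sum>j = 1..t. a j) + (N - real t * \<mu>) * a (t + 1)
        \<le> \<mu> * (\<Sum>j = 2..t + 1. a j) + (N - real t * \<mu>) * a 1"
      unfolding shift by (simp add: algebra_simps)
    then show ?thesis using False greedy[OF t] by (simp add: N_def a_def)
  qed
qed

end
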